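(* Let $n$ be an even positive integer, and let $a_1,\ldots,a_n$ be real numbers such that $\sum_{i=1}^n a_i^2=1$. Then, for every integer $r\ge 1$, $$h_{2r}(a_1,\ldots,a_n)\ \ge\ \frac{\left(\frac n2+r-1\right)!}{r!\,\left(\frac n2-1\right)!\,n^r},$$ and this inequality is sharp, with equality achieved if and only if $(a_1,\ldots,a_n)$ is a permutation of the vector $$\tilde a=\Big(\underbrace{\tfrac1{\sqrt n},\ldots,\tfrac1{\sqrt n}}_{n/2},\underbrace{-\tfrac1{\sqrt n},\ldots,-\tfrac1{\sqrt n}}_{n/2}\Big).$$
   Context: For an integer $k\ge 0$, $h_k$ denotes the complete homogeneous symmetric polynomial of degree $k$: $h_k(a_1,\ldots,a_n)=\sum_{1\le i_1\le\cdots\le i_k\le n}a_{i_1}\cdots a_{i_k}$, with $h_0=1$.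
   Formalization: The "only if" half of the equality claim is proved for r ≥ 2 or n = 2 only; for r = 1 and n ≥ 4 it is false, since equality then holds whenever the a_i sum to 0, e.g. (1/√2, −1/√2, 0, …, 0). All else is for every r ≥ 1. *)

theory Defs
  imports Complex_Main "HOL-Combinatorics.Permutations"
begin

text \<open>Vectors \<open>(a\<^sub>1, \<dots>, a\<^sub>n)\<close> are functions on \<^typ>\<open>nat\<close> of which only the values
  on \<open>{1..n}\<close> matter.  A sorted list \<open>[i\<^sub>1, \<dots>, i\<^sub>k]\<close> over \<open>{1..n}\<close> is an
  index tuple \<open>1 \<le> i\<^sub>1 \<le> \<dots> \<le> i\<^sub>k \<le> n\<close>.\<close>

definition complete_homogeneous :: "nat \<Rightarrow> nat \<Rightarrow> (nat \<Rightarrow> 'a::comm_semiring_1) \<Rightarrow> 'a" where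
  "complete_homogeneous k n a =
     (\<Sum>is \<in> {is. length is = k \<and> sorted is \<and> set is \<subseteq> {1..n}}. prod_list (map a is))"

lemma finite_complete_homogeneous_index:
  "finite {is::nat list. length is = k \<and> sorted is \<and> set is \<subseteq> {1..n}}"
  by (rule finite_subset[OF _ finite_lists_length_eq[of "{1..n}" k]]) auto

lemma complete_homogeneous_0: "complete_homogeneous 0 n a = 1"
proof -
  have "{is::nat list. length is = 0 \<and> sorted is \<and> set is \<subseteq> {1..n}} = {[]}"
    by auto
  then show ?thesis
    by (simp add: complete_homogeneous_def)
qed

definition balanced_vector :: "nat \<Rightarrow> nat \<Rightarrow> real" where
  "balanced_vector n i = (if i \<le> n div 2 then 1 / sqrt (real n) else - 1 / sqrt (real n))"

definition is_rearrangement :: "nat \<Rightarrow> (nat \<Rightarrow> 'a) \<Rightarrow> (nat \<Rightarrow> 'a) \<Rightarrow> bool" where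
  "is_rearrangement n a b \<longleftrightarrow> (\<exists>p. p permutes {1..n} \<and> (\<forall>i\<in>{1..n}. a i = b (p i)))"

text \<open>Meant for even \<open>n > 0\<close> and \<open>r \<ge> 1\<close>, where the division is exact and no
  subtraction is truncated.\<close>

definition even_degree_bound :: "nat \<Rightarrow> nat \<Rightarrow> real" where
  "even_degree_bound n r =
     fact (n div 2 + r - 1) / (fact r * fact (n div 2 - 1) * real n ^ r)"

end

theory Submission
  imports Defs "HOL-Analysis.Function_Topology" "HOL-Computational_Algebra.Formal_Power_Series"
begin

text \<open>
  Write \<open>h\<^sub>k(M)\<close> for the complete homogeneous symmetric polynomial at a multiset \<open>M\<close> of reals,
  \<open>|M|\<^sup>2\<close> for its sum of squares and \<open>B(n, r)\<close> for the claimed bound.  The proof is an induction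
  on \<open>r\<close> over all even \<open>n\<close> simultaneously: the bound for \<open>r + 1\<close> and \<open>n\<close> numbers comes from the
  bound for \<open>r\<close> and \<open>n + 2\<close> numbers.

  Let \<open>M\<close> minimise \<open>h\<^bsub>2r+2\<^esub>\<close> on the unit sphere; \<open>M\<close> exists by compactness.  The partial
  derivative of \<open>h\<^bsub>k+1\<^esub>\<close> in the variable \<open>x\<close> is \<open>h\<^sub>k\<close> with \<open>x\<close> adjoined once more, so
  Lagrange's condition reads \<open>h\<^bsub>2r+1\<^esub>(M, x) = 2(r+1) h\<^bsub>2r+2\<^esub>(M) x\<close> for every entry \<open>x\<close>.
  Subtracting it for two different entries and using the divided difference identity
  \<open>h\<^bsub>k+1\<^esub>(M, x) - h\<^bsub>k+1\<^esub>(M, y) = (x - y) h\<^sub>k(M, x, y)\<close> gives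
  \<open>h\<^bsub>2r\<^esub>(M, x, y) = 2(r+1) h\<^bsub>2r+2\<^esub>(M)\<close>.  By the induction hypothesis the left side is at
  least \<open>B(n+2, r) (1 + x\<^sup>2 + y\<^sup>2)\<^sup>r\<close>, and since \<open>2(r+1) B(n, r+1) = B(n+2, r) (1 + 2/n)\<^sup>r\<close>
  the bound for \<open>M\<close> follows as soon as there are different entries with \<open>x\<^sup>2 + y\<^sup>2 \<ge> 2/n\<close>.

  For \<open>x\<close> take an entry \<open>\<alpha>\<close> of largest modulus; say \<open>\<alpha> > 0\<close>.  If at most half of the entries
  equal \<open>\<alpha>\<close>, averaging the squares yields a suitable \<open>y\<close> (\<open>exists_large_partner\<close>).  If more than
  half of them equal \<open>\<alpha>\<close>, then changing the sign of one \<open>\<alpha>\<close> would decrease \<open>h\<^bsub>2r+2\<^esub>\<close>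
  by \<open>2\<alpha> h\<^bsub>2r+1\<^esub>(M, -\<alpha>)\<close>, contradicting minimality: \<open>h\<^bsub>2r+1\<^esub>\<close> is increasing in each
  variable because \<open>h\<^bsub>2r\<^esub>\<close> is nonnegative by induction, so all other entries may be lowered
  to \<open>-\<alpha>\<close>, and with a majority of \<open>\<alpha>\<close>'s the value is then visibly positive
  (\<open>hom_sym_odd_majority_pos\<close>).

  For \<open>r \<ge> 1\<close>, equality in the bound for \<open>r + 1\<close> forces every step to be sharp: all entries
  \<open>y \<noteq> \<alpha>\<close> satisfy \<open>\<alpha>\<^sup>2 + y\<^sup>2 = 2/n\<close>, and \<open>(M, \<alpha>, y)\<close> is an equality case for \<open>r\<close>.  Equality
  cases have sum zero, for \<open>r = 1\<close> because \<open>2 h\<^sub>2\<close> is the square of the sum plus the sum of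
  squares, so all these \<open>y\<close> coincide; the two-valued vectors that remain are balanced.
\<close>

section \<open>Complete homogeneous symmetric polynomials on multisets\<close>

definition geometric_fps :: "'a::comm_ring_1 \<Rightarrow> 'a fps" where
  "geometric_fps x = Abs_fps (\<lambda>k. x ^ k)"

text \<open>Multisets make the symmetry of \<open>h\<^sub>k\<close> part of the representation, and the product of the
  geometric series \<open>1 / (1 - x X)\<close> is its generating function.\<close>

definition hom_sym :: "nat \<Rightarrow> 'a::comm_ring_1 multiset \<Rightarrow> 'a" where
  "hom_sym k M = fps_nth (\<Prod>x\<in>#M. geometric_fps x) k"

lemma geometric_fps_inverse: "geometric_fps x * (1 - fps_const x * fps_X) = 1"
proof -
  have "geometric_fps x = 1 + fps_const x * (geometric_fps x * fps_X)"
  proof (rule fps_ext)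
    fix k
    show "fps_nth (geometric_fps x) k = fps_nth (1 + fps_const x * (geometric_fps x * fps_X)) k"
      by (cases k) (simp_all add: geometric_fps_def)
  qed
  then show ?thesis
    by (simp add: algebra_simps)
qed

lemma hom_sym_0 [simp]: "hom_sym 0 M = 1"
  by (induction M) (simp_all add: hom_sym_def geometric_fps_def)

lemma hom_sym_empty: "hom_sym (Suc k) {#} = 0"
  by (simp add: hom_sym_def)

lemma hom_sym_Suc_add_mset:
  "hom_sym (Suc k) (add_mset x M) = hom_sym (Suc k) M + x * hom_sym k (add_mset x M)"
proof -
  let ?P = "\<Prod>y\<in>#M. geometric_fps y"
  have "geometric_fps x = 1 + fps_const x * (geometric_fps x * fps_X)"
    using geometric_fps_inverse[of x] by (simp add: algebra_simps)
  then have "geometric_fps x * ?P = (1 + fps_const x * (geometric_fps x * fps_X)) * ?P"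
    by simp
  also have "\<dots> = ?P + fps_const x * ((geometric_fps x * ?P) * fps_X)"
    by (simp add: algebra_simps)
  finally have "fps_nth (geometric_fps x * ?P) (Suc k) =
      fps_nth (?P + fps_const x * ((geometric_fps x * ?P) * fps_X)) (Suc k)"
    by simp
  then show ?thesis
    by (simp add: hom_sym_def)
qed

text \<open>The divided difference identity comes from the partial fraction identity
  \<open>1 / (1 - x X) - 1 / (1 - y X) = (x - y) X / ((1 - x X) (1 - y X))\<close>.  It replaces all formulas
  for partial derivatives below.\<close>

lemma hom_sym_diff:
  "hom_sym (Suc k) (add_mset x M) - hom_sym (Suc k) (add_mset y M) =
   (x - y) * hom_sym k (add_mset x (add_mset y M))"
proof -
  let ?P = "\<Prod>z\<in>#M. geometric_fps z"
  let ?g = "geometric_fps x" and ?h = "geometric_fps y"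
  have "?g - ?h = ?g * (?h * (1 - fps_const y * fps_X)) - ?h * (?g * (1 - fps_const x * fps_X))"
    by (simp add: geometric_fps_inverse)
  also have "\<dots> = fps_const (x - y) * (?g * ?h * fps_X)"
    by (simp add: algebra_simps flip: fps_const_sub)
  finally have "(?g - ?h) * ?P = fps_const (x - y) * (?g * ?h * fps_X) * ?P"
    by simp
  also have "\<dots> = fps_const (x - y) * ((?g * (?h * ?P)) * fps_X)"
    by (simp only: mult_ac)
  finally have "?g * ?P - ?h * ?P = fps_const (x - y) * ((?g * (?h * ?P)) * fps_X)"
    by (simp only: left_diff_distrib)
  then have "fps_nth (?g * ?P - ?h * ?P) (Suc k) =
      fps_nth (fps_const (x - y) * ((?g * (?h * ?P)) * fps_X)) (Suc k)"
    by simp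
  then show ?thesis
    by (simp add: hom_sym_def)
qed

text \<open>A pair \<open>x, -x\<close> contributes the factor \<open>1 / (1 - x\<^sup>2 X\<^sup>2)\<close> to the generating function.\<close>

lemma hom_sym_add_opposite_pair:
  "hom_sym (Suc (Suc k)) (add_mset x (add_mset (- x) M)) =
   hom_sym (Suc (Suc k)) M + x\<^sup>2 * hom_sym k (add_mset x (add_mset (- x) M))"
  using hom_sym_Suc_add_mset[of "Suc k" x "add_mset (- x) M"]
    hom_sym_Suc_add_mset[of "Suc k" "- x" M] hom_sym_Suc_add_mset[of k x "add_mset (- x) M"]
  by (simp add: algebra_simps power2_eq_square)

lemma hom_sym_scale: "hom_sym k (image_mset ((*) c) M) = c ^ k * hom_sym k M"
proof (induction M arbitrary: k)
  case empty
  show ?case by (cases k) (simp_all add: hom_sym_empty)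
next
  case (add x M)
  show ?case
  proof (induction k)
    case (Suc k)
    then show ?case
      by (simp add: hom_sym_Suc_add_mset add.IH) (simp add: algebra_simps)
  qed simp
qed

lemma hom_sym_1: "hom_sym (Suc 0) M = \<Sum>\<^sub># M"
  by (induction M) (simp_all add: hom_sym_Suc_add_mset hom_sym_empty)

lemma hom_sym_2:
  fixes M :: "'a::comm_ring_1 multiset"
  shows "2 * hom_sym 2 M = (\<Sum>\<^sub># M)\<^sup>2 + (\<Sum>x\<in>#M. x\<^sup>2)"
proof (induction M)
  case empty
  show ?case by (simp add: numeral_2_eq_2 hom_sym_empty)
next
  case (add x M)
  have "hom_sym 2 (add_mset x M) = hom_sym 2 M + x * \<Sum>\<^sub># (add_mset x M)"
    using hom_sym_Suc_add_mset[of 1 x M] by (simp add: numeral_2_eq_2 hom_sym_1)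
  with add.IH show ?case
    by (simp add: algebra_simps power2_eq_square)
qed

lemma complete_homogeneous_empty: "complete_homogeneous (Suc k) 0 a = 0"
proof -
  have "{js::nat list. length js = Suc k \<and> sorted js \<and> set js \<subseteq> {1..0}} = {}"
    by (force simp: length_Suc_conv)
  then show ?thesis
    unfolding complete_homogeneous_def by (simp only: sum.empty)
qed

text \<open>Sorted index lists over \<open>{1..n+1}\<close> either avoid \<open>n + 1\<close> or end in it.\<close>

lemma complete_homogeneous_Suc_Suc:
  fixes a :: "nat \<Rightarrow> 'a::comm_semiring_1"
  shows "complete_homogeneous (Suc k) (Suc n) a =
    complete_homogeneous (Suc k) n a + a (Suc n) * complete_homogeneous k (Suc n) a"
proof -
  let ?I = "\<lambda>k n. {js::nat list. length js = k \<and> sorted js \<and> set js \<subseteq> {1..n}}"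
  let ?app = "\<lambda>js. js @ [Suc n]"
  have split: "?I (Suc k) (Suc n) = ?I (Suc k) n \<union> ?app ` ?I k (Suc n)"
  proof (intro equalityI subsetI)
    fix js
    assume "js \<in> ?I (Suc k) (Suc n)"
    then obtain ks j where js: "js = ks @ [j]" "length ks = k" "sorted (ks @ [j])"
      "set (ks @ [j]) \<subseteq> {1..Suc n}"
      by (cases js rule: rev_cases) auto
    show "js \<in> ?I (Suc k) n \<union> ?app ` ?I k (Suc n)"
    proof (cases "j = Suc n")
      case True
      with js have "ks \<in> ?I k (Suc n)" by (auto simp: sorted_append)
      with True js show ?thesis by blast
    next
      case False
      with js show ?thesis by (force simp: sorted_append)
    qed
  next
    fix js
    assume "js \<in> ?I (Suc k) n \<union> ?app ` ?I k (Suc n)"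
    then show "js \<in> ?I (Suc k) (Suc n)"
      by (fastforce simp: sorted_append)
  qed
  have disj: "?I (Suc k) n \<inter> ?app ` ?I k (Suc n) = {}"
    by auto
  have "complete_homogeneous (Suc k) (Suc n) a = complete_homogeneous (Suc k) n a +
      (\<Sum>js\<in>?app ` ?I k (Suc n). prod_list (map a js))"
    unfolding complete_homogeneous_def split
    by (rule sum.union_disjoint[OF _ _ disj])
      (auto simp only: finite_complete_homogeneous_index intro: finite_imageI)
  also have "(\<Sum>js\<in>?app ` ?I k (Suc n). prod_list (map a js)) =
      a (Suc n) * complete_homogeneous k (Suc n) a"
    unfolding complete_homogeneous_def
    by (subst sum.reindex) (auto simp: inj_on_def sum_distrib_left mult.commute)
  finally show ?thesis .
qed

lemma complete_homogeneous_eq_hom_sym: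
  "complete_homogeneous k n a = hom_sym k (image_mset a (mset_set {1..n}))"
proof (induction n arbitrary: k)
  case 0
  show ?case
    by (cases k) (simp_all add: complete_homogeneous_0 hom_sym_empty complete_homogeneous_empty[simplified])
next
  case (Suc n)
  note IH = Suc.IH
  have *: "image_mset a (mset_set {1..Suc n}) = add_mset (a (Suc n)) (image_mset a (mset_set {1..n}))"
    by (simp add: atLeastAtMostSuc_conv)
  show ?case
    unfolding *
  proof (induction k)
    case 0
    show ?case by (simp add: complete_homogeneous_0)
  next
    case (Suc k)
    then show ?case
      by (simp only: complete_homogeneous_Suc_Suc hom_sym_Suc_add_mset IH)
  qed
qed

section \<open>Signs and monotonicity\<close>

text \<open>The derivative of \<open>h\<^bsub>k+1\<^esub>\<close> in a variable is an \<open>h\<^sub>k\<close> in one variable more, so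
  nonnegativity of \<open>h\<^sub>k\<close> makes \<open>h\<^bsub>k+1\<^esub>\<close> increasing.  The part \<open>P\<close> stays fixed in the statement
  but grows in the induction, when entries of \<open>L\<close> are raised one after the other.\<close>

lemma hom_sym_mono:
  fixes f g :: "'b \<Rightarrow> real"
  assumes nonneg: "\<And>N::real multiset. size N = Suc (size P + size L) \<Longrightarrow> hom_sym k N \<ge> 0"
    and le: "\<And>x. x \<in># L \<Longrightarrow> f x \<le> g x"
  shows "hom_sym (Suc k) (P + image_mset f L) \<le> hom_sym (Suc k) (P + image_mset g L)"
  using assms
proof (induction L arbitrary: P)
  case empty
  show ?case by simp
next
  case (add x L)
  let ?R = "P + image_mset f L"
  have "hom_sym (Suc k) (add_mset (g x) ?R) - hom_sym (Suc k) (add_mset (f x) ?R) =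
      (g x - f x) * hom_sym k (add_mset (g x) (add_mset (f x) ?R))"
    by (rule hom_sym_diff)
  also have "\<dots> \<ge> 0"
    using add.prems(2)[of x] by (intro mult_nonneg_nonneg add.prems(1)) auto
  finally have "hom_sym (Suc k) (P + image_mset f (add_mset x L)) \<le>
      hom_sym (Suc k) (add_mset (g x) P + image_mset f L)"
    by simp
  also have "\<dots> \<le> hom_sym (Suc k) (add_mset (g x) P + image_mset g L)"
    using add.prems by (intro add.IH) auto
  finally show ?case by simp
qed

lemma hom_sym_replicate_pos:
  fixes x :: real
  assumes "x > 0"
  shows "hom_sym k (replicate_mset (Suc l) x) > 0"
proof (induction l arbitrary: k)
  case 0
  show ?case
    using assms by (induction k) (simp_all add: hom_sym_Suc_add_mset hom_sym_empty)
next
  case (Suc l)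
  show ?case
  proof (induction k)
    case (Suc k)
    have "hom_sym (Suc k) (replicate_mset (Suc (Suc l)) x) =
        hom_sym (Suc k) (replicate_mset (Suc l) x) + x * hom_sym k (replicate_mset (Suc (Suc l)) x)"
      unfolding replicate_mset_Suc[of "Suc l"] by (rule hom_sym_Suc_add_mset)
    then show ?case
      using Suc assms \<open>\<And>k. 0 < hom_sym k (replicate_mset (Suc l) x)\<close>[of "Suc k"]
      by (simp add: add_pos_pos)
  qed simp
qed

text \<open>The generating function \<open>(1 - x X)\<^sup>-\<^sup>(\<^sup>l\<^sup>+\<^sup>1\<^sup>) (1 - x\<^sup>2 X\<^sup>2)\<^sup>-\<^sup>j\<close> has nonnegative factors,
  the first of which has only positive coefficients and the second the constant term \<open>1\<close>.\<close>

lemma hom_sym_two_valued_pos: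
  fixes x :: real
  assumes "x > 0"
  shows "hom_sym k (replicate_mset (Suc l + j) x + replicate_mset j (- x)) > 0"
proof (induction j arbitrary: k)
  case 0
  show ?case using hom_sym_replicate_pos[OF assms] by simp
next
  case (Suc j)
  let ?M = "replicate_mset (Suc l + j) x + replicate_mset j (- x)"
  have eq: "replicate_mset (Suc l + Suc j) x + replicate_mset (Suc j) (- x) =
      add_mset x (add_mset (- x) ?M)"
    by simp
  show ?case
    unfolding eq
  proof (induction k rule: less_induct)
    case (less k)
    consider "k = 0" | "k = 1" | i where "k = Suc (Suc i)"
      by (metis One_nat_def not0_implies_Suc)
    then show ?case
    proof cases
      case 2
      with Suc[of 1] show ?thesis by (simp add: hom_sym_1)
    next
      case 3
      with less[of i] Suc[of k] assms show ?thesis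
        by (simp only: hom_sym_add_opposite_pair) (simp add: add_pos_pos)
    qed simp
  qed
qed

text \<open>By monotonicity, all entries other than \<open>x\<close> may be lowered to \<open>-x\<close>; the majority of \<open>x\<close>
  then leaves unpaired copies of \<open>x\<close>.\<close>

lemma hom_sym_odd_majority_pos:
  fixes K :: "real multiset"
  assumes nonneg: "\<And>N::real multiset. size N = Suc (size K) \<Longrightarrow> hom_sym k N \<ge> 0"
    and "x > 0" and ge: "\<And>y. y \<in># K \<Longrightarrow> - x \<le> y"
    and majority: "size K < 2 * count K x"
  shows "hom_sym (Suc k) K > 0"
proof -
  define L where "L = filter_mset (\<lambda>y. y \<noteq> x) K"
  define P where "P = replicate_mset (count K x) x"
  have K: "K = P + L"
    by (simp add: P_def L_def multiset_eq_iff)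
  have "size K = count K x + size L"
    by (subst K) (simp add: P_def)
  then obtain l where l: "count K x = Suc l + size L"
    using majority by (metis add_Suc_right add_less_cancel_left less_iff_Suc_add mult_2 add.commute)
  have "0 < hom_sym (Suc k) (P + image_mset (\<lambda>_. - x) L)"
    unfolding P_def l using hom_sym_two_valued_pos[OF \<open>x > 0\<close>, of "Suc k" l "size L"]
    by (simp add: image_mset_const_eq)
  also have "\<dots> \<le> hom_sym (Suc k) (P + image_mset id L)"
    using nonneg ge by (intro hom_sym_mono) (auto simp: K)
  finally show ?thesis by (simp add: K)
qed

text \<open>This is the binomial series of \<open>(1 - s\<^sup>2 X\<^sup>2)\<^sup>-\<^sup>m\<close>; the opposite-pair recursion is Pascal's rule.
  For \<open>m = r = 0\<close> the truncated \<open>m + r - 1\<close> still gives the correct value \<open>1\<close>.\<close>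

lemma hom_sym_balanced:
  "hom_sym (2 * r) (replicate_mset m s + replicate_mset m (- s)) = of_nat (m + r - 1 choose r) * s ^ (2 * r)"
proof (induction m arbitrary: r)
  case 0
  show ?case by (cases r) (simp_all add: hom_sym_empty binomial_eq_0)
next
  case (Suc m)
  show ?case
  proof (induction r)
    case (Suc r)
    have "hom_sym (2 * Suc r) (replicate_mset (Suc m) s + replicate_mset (Suc m) (- s)) =
       hom_sym (2 * Suc r) (replicate_mset m s + replicate_mset m (- s))
       + s\<^sup>2 * hom_sym (2 * r) (replicate_mset (Suc m) s + replicate_mset (Suc m) (- s))"
      using hom_sym_add_opposite_pair[of "2 * r" s "replicate_mset m s + replicate_mset m (- s)"]
      by (simp add: add_mset_commute)
    also have "\<dots> = of_nat ((m + r choose Suc r) + (m + r choose r)) * s ^ (2 * Suc r)"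
      unfolding Suc.IH \<open>\<And>r. hom_sym (2 * r) (replicate_mset m s + _) = _\<close>
      by (simp add: algebra_simps power2_eq_square)
    finally show ?case by (simp add: add.commute)
  qed simp
qed

section \<open>Sums of squares\<close>

definition sum_squares :: "real multiset \<Rightarrow> real" where
  "sum_squares M = (\<Sum>x\<in>#M. x\<^sup>2)"

lemma sum_squares_add_mset [simp]: "sum_squares (add_mset x M) = x\<^sup>2 + sum_squares M"
  by (simp add: sum_squares_def)

lemma sum_squares_empty [simp]: "sum_squares {#} = 0"
  by (simp add: sum_squares_def)

lemma sum_squares_nonneg [simp]: "sum_squares M \<ge> 0"
  by (induction M) auto

lemma sum_squares_union [simp]: "sum_squares (M + N) = sum_squares M + sum_squares N"
  by (simp add: sum_squares_def)

lemma sum_squares_replicate [simp]: "sum_squares (replicate_mset k x) = real k * x\<^sup>2"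
  by (induction k) (auto simp: algebra_simps)

lemma sum_squares_scale: "sum_squares (image_mset ((*) c) M) = c\<^sup>2 * sum_squares M"
  by (induction M) (auto simp: algebra_simps power_mult_distrib)

lemma sum_squares_eq_0: "sum_squares M = 0 \<Longrightarrow> x \<in># M \<Longrightarrow> x = 0"
  by (induction M) (auto simp: add_nonneg_eq_0_iff)

lemma sum_squares_le: "(\<And>x. x \<in># M \<Longrightarrow> x\<^sup>2 \<le> c) \<Longrightarrow> sum_squares M \<le> real (size M) * c"
proof (induction M)
  case (add x M)
  then have "x\<^sup>2 \<le> c" "sum_squares M \<le> real (size M) * c" by auto
  then show ?case by (simp add: algebra_simps)
qed simp

lemma unit_multiset_scaling:
  assumes "sum_squares M > 0"
  obtains N s where "s > 0" "s\<^sup>2 = sum_squares M" "sum_squares N = 1" "M = image_mset ((*) s) N"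
proof
  let ?s = "sqrt (sum_squares M)"
  let ?N = "image_mset ((*) (1 / ?s)) M"
  show "?s > 0" "?s\<^sup>2 = sum_squares M"
    using assms by simp_all
  show "sum_squares ?N = 1"
    using assms by (simp only: sum_squares_scale) (simp add: power_divide)
  have "(*) ?s \<circ> (*) (1 / ?s) = id"
    using assms by auto
  then show "M = image_mset ((*) ?s) ?N"
    by (simp only: multiset.map_comp multiset.map_id)
qed

text \<open>A bound on the unit sphere extends to all multisets by homogeneity.  In this form it can be
  differentiated in a single variable, without a constraint.\<close>

lemma hom_sym_homogeneous_bound:
  assumes bound: "\<And>N. size N = size M \<Longrightarrow> sum_squares N = 1 \<Longrightarrow> c \<le> hom_sym (2 * Suc k) N"
  shows "c * sum_squares M ^ Suc k \<le> hom_sym (2 * Suc k) M"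
proof (cases "sum_squares M = 0")
  case True
  have "image_mset ((*) 0) M = image_mset id M"
    by (rule image_mset_cong) (use sum_squares_eq_0[OF True] in auto)
  then have "hom_sym (2 * Suc k) M = 0"
    using hom_sym_scale[of "2 * Suc k" 0 M] by simp
  with True show ?thesis by simp
next
  case False
  then have "sum_squares M > 0"
    using sum_squares_nonneg[of M] by linarith
  then obtain N s where N: "s > 0" "s\<^sup>2 = sum_squares M" "sum_squares N = 1"
    "M = image_mset ((*) s) N"
    by (rule unit_multiset_scaling)
  have "c * sum_squares M ^ Suc k = s ^ (2 * Suc k) * c"
    unfolding N(2)[symmetric] power_mult by (rule mult.commute)
  also have "\<dots> \<le> s ^ (2 * Suc k) * hom_sym (2 * Suc k) N"
    using N bound[of N] by (intro mult_left_mono) auto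
  also have "\<dots> = hom_sym (2 * Suc k) M"
    unfolding N(4) hom_sym_scale ..
  finally show ?thesis .
qed

section \<open>Minimisers on the unit sphere\<close>

definition sphere_minimiser :: "nat \<Rightarrow> real multiset \<Rightarrow> bool" where
  "sphere_minimiser k M \<longleftrightarrow> sum_squares M = 1 \<and>
     (\<forall>N. size N = size M \<longrightarrow> sum_squares N = 1 \<longrightarrow> hom_sym k M \<le> hom_sym k N)"

lemma multiset_as_vector:
  fixes N :: "'a::zero multiset"
  assumes "size N = n"
  obtains b where "image_mset b (mset_set {1..n}) = N" "\<And>i. i \<notin> {1..n} \<Longrightarrow> b i = 0"
proof -
  obtain xs where xs: "mset xs = N"
    using ex_mset by blast
  define b where "b = (\<lambda>i. if i \<in> {1..n} then xs ! (i - 1) else 0)"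
  have "length xs = n"
    using xs assms by auto
  then have "map b [1..<Suc n] = xs"
    by (intro nth_equalityI) (auto simp: b_def simp del: upt_Suc)
  then have "image_mset b (mset [1..<Suc n]) = N"
    using xs by (metis mset_map)
  also have "mset [1..<Suc n] = mset_set {1..n}"
    by (metis atLeastLessThanSuc_atLeastAtMost mset_upt)
  finally show thesis
    by (rule that) (auto simp: b_def)
qed

lemma sum_squares_image_mset: "sum_squares (image_mset a (mset_set A)) = (\<Sum>i\<in>A. (a i)\<^sup>2)"
  by (simp add: sum_squares_def sum_unfold_sum_mset image_mset.compositionality comp_def)

lemma continuous_on_complete_homogeneous:
  "continuous_on S (\<lambda>a :: nat \<Rightarrow> real. complete_homogeneous k n a)"
proof -
  have coord: "continuous_on S (\<lambda>a :: nat \<Rightarrow> real. a i)" for i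
    by (rule continuous_on_subset[OF continuous_on_product_coordinates]) simp
  have "continuous_on S (\<lambda>a :: nat \<Rightarrow> real. prod_list (map a js))" for js
    by (induction js) (auto intro!: continuous_intros coord)
  then show ?thesis
    unfolding complete_homogeneous_def by (intro continuous_on_sum)
qed

text \<open>The sphere is realised among functions on the natural numbers that vanish outside \<open>{1..n}\<close>,
  inside a product of compact sets.\<close>

lemma sphere_minimiser_exists:
  assumes "n > 0"
  obtains M where "size M = n" "sphere_minimiser k M"
proof -
  (* The coordinates outside {1..n} are pinned to 0 only to make the box compact. *)
  define C :: "(nat \<Rightarrow> real) set"
    where "C = PiE UNIV (\<lambda>i. if i \<in> {1..n} then {-1..1} else {0})"
  define S where "S = C \<inter> {a. (\<Sum>i=1..n. (a i)\<^sup>2) = 1}"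
  have "compactin (product_topology (\<lambda>_. euclidean) UNIV) C"
    unfolding C_def compactin_PiE by auto
  then have "compact C"
    by (simp add: euclidean_product_topology)
  moreover have "closed {a :: nat \<Rightarrow> real. (\<Sum>i=1..n. (a i)\<^sup>2) = 1}"
    by (intro closed_Collect_eq continuous_intros continuous_on_product_coordinates)
  ultimately have "compact S"
    unfolding S_def by (rule compact_Int_closed)
  have in_S: "a \<in> S" if "(\<Sum>i=1..n. (a i)\<^sup>2) = 1" "\<And>i. i \<notin> {1..n} \<Longrightarrow> a i = 0" for a
  proof -
    have "(a i)\<^sup>2 \<le> 1" if "i \<in> {1..n}" for i
      using \<open>(\<Sum>i=1..n. (a i)\<^sup>2) = 1\<close> that
      by (metis finite_atLeastAtMost member_le_sum zero_le_power2 DiffD1)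
    then have "\<bar>a i\<bar> \<le> 1" if "i \<in> {1..n}" for i
      using that abs_square_le_1 by blast
    then show ?thesis
      using that by (auto simp: S_def C_def abs_le_iff minus_le_iff)
  qed
  have "(\<Sum>i=1..n. (if i = 1 then 1 else 0 :: real)\<^sup>2) = (\<Sum>i=1..n. if i = 1 then 1 else 0)"
    by (rule sum.cong) auto
  also have "\<dots> = 1"
    using assms by simp
  finally have "(\<lambda>i. if i = 1 then 1 else 0) \<in> S"
    using assms by (intro in_S) auto
  with \<open>compact S\<close> obtain a where a: "a \<in> S"
    "\<And>b. b \<in> S \<Longrightarrow> complete_homogeneous k n a \<le> complete_homogeneous k n b"
    using continuous_attains_inf[of S "complete_homogeneous k n"] continuous_on_complete_homogeneous
    by blast
  show thesis
  proof
    let ?M = "image_mset a (mset_set {1..n})"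
    show size: "size ?M = n" by simp
    have "hom_sym k ?M \<le> hom_sym k N" if N: "size N = n" "sum_squares N = 1" for N
    proof -
      obtain b where b: "image_mset b (mset_set {1..n}) = N" "\<And>i. i \<notin> {1..n} \<Longrightarrow> b i = 0"
        by (rule multiset_as_vector[OF N(1)]) blast
      with N(2) have "b \<in> S"
        by (intro in_S) (auto simp: sum_squares_image_mset)
      with a(2) show ?thesis
        using b(1) by (metis complete_homogeneous_eq_hom_sym)
    qed
    moreover have "sum_squares ?M = 1"
      using a(1) by (simp add: S_def sum_squares_image_mset)
    ultimately show "sphere_minimiser k ?M"
      unfolding sphere_minimiser_def size by blast
  qed
qed

lemma isCont_hom_sym: "isCont (\<lambda>t::real. hom_sym k (add_mset t M)) x"
  by (induction k) (auto simp: hom_sym_Suc_add_mset intro!: continuous_intros)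

text \<open>The homogeneous bound says that
  \<open>h\<^bsub>2k+2\<^esub>(t, R) - h\<^bsub>2k+2\<^esub>(M) (t\<^sup>2 + |R|\<^sup>2)\<^sup>k\<^sup>+\<^sup>1\<close>, where \<open>R\<close> is \<open>M\<close> without \<open>x\<close>, is nonnegative for
  all real \<open>t\<close>.  It vanishes at \<open>t = x\<close>, hence so does its derivative there.  This yields the value
  of the Lagrange multiplier directly.\<close>

lemma minimiser_lagrange:
  assumes min: "sphere_minimiser (2 * Suc k) M" and x: "x \<in># M"
  shows "hom_sym (Suc (2 * k)) (add_mset x M) = 2 * real (Suc k) * hom_sym (2 * Suc k) M * x"
proof -
  obtain R where R: "M = add_mset x R"
    using x by (metis multi_member_split)
  let ?c = "hom_sym (2 * Suc k) M"
  let ?f = "\<lambda>t. hom_sym (2 * Suc k) (add_mset t R)"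
  let ?g = "\<lambda>t. ?c * (t\<^sup>2 + sum_squares R) ^ Suc k"
  let ?d = "hom_sym (Suc (2 * k)) (add_mset x (add_mset x R))"
  have f': "(?f has_real_derivative ?d) (at x)"
    unfolding CARAT_DERIV
  proof (intro exI conjI allI)
    fix t
    show "?f t - ?f x = hom_sym (Suc (2 * k)) (add_mset t (add_mset x R)) * (t - x)"
      using hom_sym_diff[of "Suc (2 * k)" t R x] by (simp add: mult.commute)
  qed (auto intro: isCont_hom_sym)
  have g': "(?g has_real_derivative ?c * (real (Suc k) * (x\<^sup>2 + sum_squares R) ^ k * (2 * x))) (at x)"
    by (rule derivative_eq_intros refl)+ simp
  have unit: "x\<^sup>2 + sum_squares R = 1"
    using min R by (simp add: sphere_minimiser_def)
  have deriv: "((\<lambda>t. ?f t - ?g t) has_real_derivative ?d - 2 * real (Suc k) * ?c * x) (at x)"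
    using DERIV_diff[OF f' g'] unfolding unit by (simp only: power_one mult_1_left mult_1_right mult_ac)
  have "?f x - ?g x = 0"
    using unit R by simp
  moreover have "?f t - ?g t \<ge> 0" for t
    using hom_sym_homogeneous_bound[of "add_mset t R" ?c k] min R
    by (simp add: sphere_minimiser_def)
  ultimately have "?d - 2 * real (Suc k) * ?c * x = 0"
    by (intro DERIV_local_min[OF deriv zero_less_one]) simp
  then show ?thesis
    using R by simp
qed

lemma minimiser_pair:
  assumes min: "sphere_minimiser (2 * Suc k) M" and "x \<in># M" "y \<in># M" "x \<noteq> y"
  shows "hom_sym (2 * k) (add_mset x (add_mset y M)) = 2 * real (Suc k) * hom_sym (2 * Suc k) M"
proof -
  have "(x - y) * hom_sym (2 * k) (add_mset x (add_mset y M)) =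
      (x - y) * (2 * real (Suc k) * hom_sym (2 * Suc k) M)"
    using minimiser_lagrange[OF min \<open>x \<in># M\<close>] minimiser_lagrange[OF min \<open>y \<in># M\<close>]
      hom_sym_diff[of "2 * k" x M y] by (simp only: right_diff_distrib left_diff_distrib) (simp add: mult_ac)
  with \<open>x \<noteq> y\<close> show ?thesis by simp
qed

lemma sphere_minimiser_uminus:
  assumes "sphere_minimiser (2 * k) M"
  shows "sphere_minimiser (2 * k) (image_mset ((*) (-1)) M)"
  using assms by (simp add: sphere_minimiser_def sum_squares_scale hom_sym_scale)

text \<open>Otherwise changing the sign of one copy of \<open>\<alpha>\<close> would lower \<open>h\<^bsub>2k+2\<^esub>\<close>.  The size must be
  even: a majority of \<open>\<alpha>\<close>'s among an even number of entries is a lead of at least two, so one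
  more \<open>-\<alpha>\<close> does not destroy it.\<close>

lemma minimiser_count_pos:
  assumes min: "sphere_minimiser (2 * Suc k) M"
    and nonneg: "\<And>N::real multiset. size N = size M + 2 \<Longrightarrow> hom_sym (2 * k) N \<ge> 0"
    and "even (size M)"
    and \<alpha>: "\<alpha> \<in># M" "\<alpha> > 0" "\<And>y. y \<in># M \<Longrightarrow> \<bar>y\<bar> \<le> \<bar>\<alpha>\<bar>"
  shows "2 * count M \<alpha> \<le> size M"
proof (rule ccontr)
  assume majority: "\<not> 2 * count M \<alpha> \<le> size M"
  obtain R where R: "M = add_mset \<alpha> R"
    using \<alpha>(1) by (metis multi_member_split)
  have "hom_sym (Suc (2 * k)) (add_mset (- \<alpha>) M) > 0"
  proof (rule hom_sym_odd_majority_pos)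
    show "size (add_mset (- \<alpha>) M) < 2 * count (add_mset (- \<alpha>) M) \<alpha>"
      using majority \<open>even (size M)\<close> \<open>\<alpha> > 0\<close> by (auto elim!: evenE)
    show "- \<alpha> \<le> y" if "y \<in># add_mset (- \<alpha>) M" for y
      using that \<alpha>(2) \<alpha>(3)[of y] by auto
  qed (use nonneg \<alpha> in auto)
  moreover have "hom_sym (2 * Suc k) M - hom_sym (2 * Suc k) (add_mset (- \<alpha>) R) =
      2 * \<alpha> * hom_sym (Suc (2 * k)) (add_mset (- \<alpha>) M)"
    using hom_sym_diff[of "Suc (2 * k)" \<alpha> R "- \<alpha>"] by (simp add: R add_mset_commute)
  ultimately have "hom_sym (2 * Suc k) (add_mset (- \<alpha>) R) < hom_sym (2 * Suc k) M"
    using \<alpha>(2) by (metis diff_gt_0_iff_gt mult_pos_pos zero_less_numeral)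
  moreover have "hom_sym (2 * Suc k) M \<le> hom_sym (2 * Suc k) (add_mset (- \<alpha>) R)"
    using min by (simp add: sphere_minimiser_def R)
  ultimately show False by simp
qed

lemma minimiser_count:
  assumes min: "sphere_minimiser (2 * Suc k) M"
    and nonneg: "\<And>N::real multiset. size N = size M + 2 \<Longrightarrow> hom_sym (2 * k) N \<ge> 0"
    and "even (size M)"
    and \<alpha>: "\<alpha> \<in># M" "\<And>y. y \<in># M \<Longrightarrow> \<bar>y\<bar> \<le> \<bar>\<alpha>\<bar>"
  shows "2 * count M \<alpha> \<le> size M"
proof -
  consider "\<alpha> > 0" | "\<alpha> = 0" | "\<alpha> < 0" by linarith
  then show ?thesis
  proof cases
    case 1
    show ?thesis
      using min nonneg \<open>even (size M)\<close> \<alpha>(1) 1 \<alpha>(2) by (rule minimiser_count_pos)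
  next
    case 2
    then have "sum_squares M \<le> real (size M) * 0"
      using \<alpha>(2) by (intro sum_squares_le) auto
    then show ?thesis
      using min by (simp add: sphere_minimiser_def)
  next
    case 3
    let ?M = "image_mset ((*) (-1)) M"
    have "2 * count ?M (- 1 * \<alpha>) \<le> size ?M"
      using 3 nonneg \<open>even (size M)\<close> \<alpha>
      by (intro minimiser_count_pos[of k] sphere_minimiser_uminus min) auto
    moreover have "count ?M (- 1 * \<alpha>) = count M \<alpha>"
      by (induction M) auto
    ultimately show ?thesis by simp
  qed
qed

text \<open>Let \<open>\<alpha>\<close> occur \<open>A\<close> times among the \<open>n\<close> entries.  Summing the nonnegative deficits
  \<open>2/n - \<alpha>\<^sup>2 - y\<^sup>2\<close> over the entries \<open>y \<noteq> \<alpha>\<close> gives \<open>(n - 2A) (1/n - \<alpha>\<^sup>2)\<close>, which is at most zero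
  because \<open>2A \<le> n\<close> and the largest square is at least the average \<open>1/n\<close>.  So everything vanishes.\<close>

lemma extremal_partner:
  assumes unit: "sum_squares M = 1"
    and \<alpha>: "\<alpha> \<in># M" "\<And>y. y \<in># M \<Longrightarrow> \<bar>y\<bar> \<le> \<bar>\<alpha>\<bar>"
    and count: "2 * count M \<alpha> \<le> size M"
    and le: "\<And>y. y \<in># M \<Longrightarrow> y \<noteq> \<alpha> \<Longrightarrow> \<alpha>\<^sup>2 + y\<^sup>2 \<le> 2 / real (size M)"
  shows "2 * count M \<alpha> = size M \<or> \<alpha>\<^sup>2 = 1 / real (size M)"
    and "\<And>y. y \<in># M \<Longrightarrow> y \<noteq> \<alpha> \<Longrightarrow> \<alpha>\<^sup>2 + y\<^sup>2 = 2 / real (size M)"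
proof -
  let ?n = "real (size M)" and ?A = "real (count M \<alpha>)"
  define L where "L = filter_mset (\<lambda>y. y \<noteq> \<alpha>) M"
  have M: "M = replicate_mset (count M \<alpha>) \<alpha> + L"
    by (simp add: L_def multiset_eq_iff)
  have "M \<noteq> {#}"
    using \<alpha>(1) by auto
  then have n: "?n > 0"
    by (simp only: nonempty_has_size)
  have "sum_squares M \<le> ?n * \<alpha>\<^sup>2"
    using \<alpha>(2) by (intro sum_squares_le) (simp add: abs_le_square_iff)
  then have \<alpha>_ge: "1 / ?n \<le> \<alpha>\<^sup>2"
    using unit n by (simp add: field_simps)
  have size_L: "real (size L) = ?n - ?A"
    using arg_cong[OF M, of "\<lambda>X. real (size X)"] by simp
  have sq_L: "sum_squares L = 1 - ?A * \<alpha>\<^sup>2"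
    using arg_cong[OF M, of sum_squares] unit by simp
  have deficit: "(\<Sum>y\<in>#K. c - y\<^sup>2) = real (size K) * c - sum_squares K" for K and c :: real
    by (induction K) (auto simp: algebra_simps)
  have "(\<Sum>y\<in>#L. 2 / ?n - \<alpha>\<^sup>2 - y\<^sup>2) = (?n - 2 * ?A) * (1 / ?n - \<alpha>\<^sup>2)"
    unfolding deficit size_L sq_L using \<open>M \<noteq> {#}\<close> by (simp add: field_simps)
  moreover have nonpos: "(?n - 2 * ?A) * (1 / ?n - \<alpha>\<^sup>2) \<le> 0"
    using count \<alpha>_ge by (intro mult_nonneg_nonpos) auto
  moreover have L_le: "2 / ?n - \<alpha>\<^sup>2 - y\<^sup>2 \<ge> 0" if "y \<in># L" for y
    using le[of y] that by (auto simp: L_def)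
  moreover have nonneg: "(\<Sum>y\<in>#K. f y) \<ge> 0" if "\<And>y. y \<in># K \<Longrightarrow> f y \<ge> 0"
    for f :: "real \<Rightarrow> real" and K
    using that by (induction K) auto
  ultimately have zero: "(?n - 2 * ?A) * (1 / ?n - \<alpha>\<^sup>2) = 0"
    and sum_zero: "(\<Sum>y\<in>#L. 2 / ?n - \<alpha>\<^sup>2 - y\<^sup>2) = 0"
    using nonneg[of L "\<lambda>y. 2 / ?n - \<alpha>\<^sup>2 - y\<^sup>2"] by auto
  from zero show "2 * count M \<alpha> = size M \<or> \<alpha>\<^sup>2 = 1 / ?n"
    by auto
  fix y assume "y \<in># M" "y \<noteq> \<alpha>"
  then have y: "y \<in># L" by (simp add: L_def)
  then obtain K where K: "L = add_mset y K"
    by (metis multi_member_split)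
  have "(\<Sum>z\<in>#K. 2 / ?n - \<alpha>\<^sup>2 - z\<^sup>2) \<ge> 0"
    using L_le K by (intro nonneg) auto
  with sum_zero L_le[OF y] show "\<alpha>\<^sup>2 + y\<^sup>2 = 2 / ?n"
    unfolding K by simp
qed

lemma exists_other_entry:
  assumes "2 * count M \<alpha> \<le> size M" "M \<noteq> {#}"
  obtains y where "y \<in># M" "y \<noteq> \<alpha>"
proof (rule ccontr)
  assume "\<not> thesis"
  then have "M = replicate_mset (size M) \<alpha>"
    using that by (metis set_mset_subset_singletonD subsetI singletonI)
  then have "count M \<alpha> = size M"
    by (metis count_replicate_mset)
  with assms show False by simp
qed

lemma exists_large_partner:
  assumes unit: "sum_squares M = 1"
    and \<alpha>: "\<alpha> \<in># M" "\<And>y. y \<in># M \<Longrightarrow> \<bar>y\<bar> \<le> \<bar>\<alpha>\<bar>"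
    and count: "2 * count M \<alpha> \<le> size M"
  obtains y where "y \<in># M" "y \<noteq> \<alpha>" "2 / real (size M) \<le> \<alpha>\<^sup>2 + y\<^sup>2"
proof -
  have "\<exists>y. y \<in># M \<and> y \<noteq> \<alpha> \<and> 2 / real (size M) \<le> \<alpha>\<^sup>2 + y\<^sup>2"
  proof (rule ccontr)
    assume "\<not> ?thesis"
    then have small: "\<alpha>\<^sup>2 + y\<^sup>2 < 2 / real (size M)" if "y \<in># M" "y \<noteq> \<alpha>" for y
      using that by force
    have "M \<noteq> {#}"
      using \<alpha>(1) by auto
    with count obtain y where y: "y \<in># M" "y \<noteq> \<alpha>"
      by (rule exists_other_entry)
    have "\<alpha>\<^sup>2 + y\<^sup>2 = 2 / real (size M)"
      by (rule extremal_partner(2)[OF unit \<alpha>(1)]) (use \<alpha>(2) count small y in \<open>auto intro: less_imp_le\<close>)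
    with small[OF y] show False by simp
  qed
  then show thesis
    using that by blast
qed

section \<open>The induction\<close>

lemma even_degree_bound_pos: "n > 0 \<Longrightarrow> even_degree_bound n r > 0"
  by (simp add: even_degree_bound_def)

lemma even_degree_bound_Suc:
  assumes "even n" "n > 0"
  shows "2 * real (Suc k) * even_degree_bound n (Suc k) =
    even_degree_bound (n + 2) k * (real (n + 2) / real n) ^ k"
proof -
  from assms obtain p where n: "n = 2 * Suc p"
    by (metis evenE gr0_implies_Suc mult_0_right not_gr0)
  have cancel: "2 * K * (c / (K * f * g * N ^ Suc k)) = c / (f * (P * g) * L ^ k) * (L / N) ^ k"
    if "K > 0" "f > 0" "g > 0" "P > 0" "L > 0" "N = 2 * P" for K c f g N P L :: real
    using that by (simp add: field_simps)
  have idx: "n div 2 + Suc k - 1 = Suc p + k" "(n + 2) div 2 + k - 1 = Suc p + k"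
    "n div 2 - 1 = p" "(n + 2) div 2 - 1 = Suc p"
    by (simp_all add: n)
  have facts: "fact (Suc k) = real (Suc k) * fact k" "fact (Suc p) = real (Suc p) * fact p"
    by simp_all
  show ?thesis
    unfolding even_degree_bound_def idx facts by (rule cancel) (simp_all add: n)
qed

definition even_bound_holds :: "nat \<Rightarrow> bool" where
  "even_bound_holds k \<longleftrightarrow> (\<forall>M. even (size M) \<longrightarrow> M \<noteq> {#} \<longrightarrow>
     even_degree_bound (size M) k * sum_squares M ^ k \<le> hom_sym (2 * k) M)"

lemma even_bound_holdsD:
  "even_bound_holds k \<Longrightarrow> even (size M) \<Longrightarrow> M \<noteq> {#} \<Longrightarrow>
     even_degree_bound (size M) k * sum_squares M ^ k \<le> hom_sym (2 * k) M"
  by (simp add: even_bound_holds_def)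

lemma exists_max_abs:
  fixes M :: "real multiset"
  assumes "M \<noteq> {#}"
  obtains \<alpha> where "\<alpha> \<in># M" "\<And>y. y \<in># M \<Longrightarrow> \<bar>y\<bar> \<le> \<bar>\<alpha>\<bar>"
proof -
  have "Max (abs ` set_mset M) \<in> abs ` set_mset M"
    using assms by (intro Max_in) auto
  then obtain \<alpha> where \<alpha>: "\<alpha> \<in># M" "\<bar>\<alpha>\<bar> = Max (abs ` set_mset M)"
    by (metis imageE)
  then have "\<bar>y\<bar> \<le> \<bar>\<alpha>\<bar>" if "y \<in># M" for y
    using that by simp
  with \<alpha>(1) show thesis by (rule that)
qed

text \<open>The last property combines the identity for pairs with the induction hypothesis for the
  \<open>n + 2\<close> numbers \<open>M, \<alpha>, y\<close>.  It serves both the bound and the discussion of equality.\<close>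

lemma minimiser_structure:
  assumes IH: "even_bound_holds k"
    and min: "sphere_minimiser (2 * Suc k) M" and even: "even (size M)"
  obtains \<alpha> where "\<alpha> \<in># M" "\<And>y. y \<in># M \<Longrightarrow> \<bar>y\<bar> \<le> \<bar>\<alpha>\<bar>" "2 * count M \<alpha> \<le> size M"
    "\<And>y. y \<in># M \<Longrightarrow> y \<noteq> \<alpha> \<Longrightarrow>
      even_degree_bound (size M + 2) k * (\<alpha>\<^sup>2 + y\<^sup>2 + 1) ^ k \<le> 2 * real (Suc k) * hom_sym (2 * Suc k) M"
proof -
  have unit: "sum_squares M = 1"
    using min by (simp add: sphere_minimiser_def)
  then have "M \<noteq> {#}" by auto
  then obtain \<alpha> where \<alpha>: "\<alpha> \<in># M" "\<And>y. y \<in># M \<Longrightarrow> \<bar>y\<bar> \<le> \<bar>\<alpha>\<bar>"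
    using exists_max_abs by blast
  have "hom_sym (2 * k) N \<ge> 0" if "size N = size M + 2" for N :: "real multiset"
  proof -
    have "0 \<le> even_degree_bound (size N) k * sum_squares N ^ k"
      using that by (intro mult_nonneg_nonneg zero_le_power less_imp_le[OF even_degree_bound_pos]) auto
    also have "\<dots> \<le> hom_sym (2 * k) N"
      using that even by (intro even_bound_holdsD[OF IH]) auto
    finally show ?thesis .
  qed
  then have "2 * count M \<alpha> \<le> size M"
    using minimiser_count[OF min _ even \<alpha>] by blast
  moreover have "even_degree_bound (size M + 2) k * (\<alpha>\<^sup>2 + y\<^sup>2 + 1) ^ k \<le>
      2 * real (Suc k) * hom_sym (2 * Suc k) M" if "y \<in># M" "y \<noteq> \<alpha>" for y
    using even_bound_holdsD[OF IH, of "add_mset \<alpha> (add_mset y M)"] even unit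
      minimiser_pair[OF min \<alpha>(1) that(1)] that(2) by (simp add: add.assoc)
  ultimately show thesis
    using \<alpha> that by blast
qed

lemma even_bound_step:
  assumes IH: "even_bound_holds k"
  shows "even_bound_holds (Suc k)"
  unfolding even_bound_holds_def
proof (intro allI impI)
  fix K :: "real multiset"
  assume K: "even (size K)" "K \<noteq> {#}"
  define n where "n = size K"
  have n: "even n" "n > 0"
    using K by (auto simp: n_def nonempty_has_size)
  obtain M where M: "size M = n" and min: "sphere_minimiser (2 * Suc k) M"
    using sphere_minimiser_exists[OF n(2)] by blast
  then have unit: "sum_squares M = 1"
    by (simp add: sphere_minimiser_def)
  obtain \<alpha> where \<alpha>: "\<alpha> \<in># M" "\<And>y. y \<in># M \<Longrightarrow> \<bar>y\<bar> \<le> \<bar>\<alpha>\<bar>" "2 * count M \<alpha> \<le> size M"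
    "\<And>y. y \<in># M \<Longrightarrow> y \<noteq> \<alpha> \<Longrightarrow>
      even_degree_bound (size M + 2) k * (\<alpha>\<^sup>2 + y\<^sup>2 + 1) ^ k \<le> 2 * real (Suc k) * hom_sym (2 * Suc k) M"
    using minimiser_structure[OF IH min] n M by blast
  obtain y where y: "y \<in># M" "y \<noteq> \<alpha>" "2 / real n \<le> \<alpha>\<^sup>2 + y\<^sup>2"
    by (rule exists_large_partner[OF unit \<alpha>(1)]) (use \<alpha>(2,3) M in auto)
  have "2 * real (Suc k) * even_degree_bound n (Suc k) =
      even_degree_bound (n + 2) k * (2 / real n + 1) ^ k"
    unfolding even_degree_bound_Suc[OF n] using n by (simp add: add_divide_distrib add.commute)
  also have "\<dots> \<le> even_degree_bound (n + 2) k * (\<alpha>\<^sup>2 + y\<^sup>2 + 1) ^ k"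
    using y(3) by (intro mult_left_mono power_mono less_imp_le[OF even_degree_bound_pos]) auto
  also have "\<dots> \<le> 2 * real (Suc k) * hom_sym (2 * Suc k) M"
    using \<alpha>(4) y M by simp
  finally have "even_degree_bound n (Suc k) \<le> hom_sym (2 * Suc k) M"
    by (simp del: of_nat_Suc)
  then have "even_degree_bound n (Suc k) \<le> hom_sym (2 * Suc k) N"
    if "size N = n" "sum_squares N = 1" for N
    using min M that unfolding sphere_minimiser_def by fastforce
  then show "even_degree_bound (size K) (Suc k) * sum_squares K ^ Suc k \<le> hom_sym (2 * Suc k) K"
    by (intro hom_sym_homogeneous_bound) (auto simp: n_def)
qed

lemma even_bound: "even_bound_holds k"
proof (induction k)
  case 0
  show ?case
    by (auto simp: even_bound_holds_def even_degree_bound_def)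
qed (rule even_bound_step)

section \<open>Equality\<close>

definition balanced_multiset :: "nat \<Rightarrow> real multiset" where
  "balanced_multiset n =
     replicate_mset (n div 2) (1 / sqrt n) + replicate_mset (n div 2) (- (1 / sqrt n))"

lemma sum_balanced_multiset: "\<Sum>\<^sub># (balanced_multiset n) = 0"
  by (simp add: balanced_multiset_def)

lemma sum_squares_balanced_multiset:
  assumes "even n" "n > 0"
  shows "sum_squares (balanced_multiset n) = 1"
  using assms by (auto simp: balanced_multiset_def power_divide elim!: evenE)

lemma hom_sym_balanced_multiset:
  assumes "even n" "n > 0"
  shows "hom_sym (2 * r) (balanced_multiset n) = even_degree_bound n r"
proof -
  have "(1 / sqrt n) ^ (2 * r) = 1 / real n ^ r"
    by (simp add: power_mult power_divide)
  moreover have "n div 2 + r - 1 - r = n div 2 - 1" "r \<le> n div 2 + r - 1"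
    using assms by (auto elim!: evenE)
  ultimately show ?thesis
    by (simp add: balanced_multiset_def hom_sym_balanced even_degree_bound_def binomial_fact)
qed

lemma opposite_pairs_eq_balanced:
  assumes "sum_squares (replicate_mset m x + replicate_mset m (- x)) = 1"
  shows "replicate_mset m x + replicate_mset m (- x) = balanced_multiset (2 * m)"
proof -
  have "real (2 * m) * x\<^sup>2 = 1"
    using assms by simp
  then have "x\<^sup>2 = (1 / sqrt (real (2 * m)))\<^sup>2"
    by (cases "m = 0") (simp_all add: power_divide field_simps)
  then have "x = 1 / sqrt (real (2 * m)) \<or> x = - (1 / sqrt (real (2 * m)))"
    by (simp only: power2_eq_iff)
  then show ?thesis
    by (auto simp: balanced_multiset_def)
qed

text \<open>The hypothesis \<open>sum_zero\<close> on the degree below is what the induction on the degree provides.  It is a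
  weaker property than being balanced, but it already holds for \<open>k = 1\<close>, where equality
  does not force balance.\<close>

lemma equality_imp_balanced:
  assumes "k \<ge> 1"
    and sum_zero: "\<And>N. even (size N) \<Longrightarrow> sum_squares N > 0 \<Longrightarrow>
      hom_sym (2 * k) N = even_degree_bound (size N) k * sum_squares N ^ k \<Longrightarrow> \<Sum>\<^sub># N = 0"
    and even: "even (size M)" and unit: "sum_squares M = 1"
    and eq: "hom_sym (2 * Suc k) M = even_degree_bound (size M) (Suc k)"
  shows "M = balanced_multiset (size M)"
proof -
  let ?n = "size M"
  have "M \<noteq> {#}" using unit by auto
  then have n: "?n > 0" by (simp only: nonempty_has_size)
  have min: "sphere_minimiser (2 * Suc k) M"
    unfolding sphere_minimiser_def
  proof (intro conjI allI impI)
    fix N :: "real multiset" assume N: "size N = size M" "sum_squares N = 1"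
    moreover from N have "N \<noteq> {#}" by auto
    ultimately show "hom_sym (2 * Suc k) M \<le> hom_sym (2 * Suc k) N"
      using even_bound_holdsD[OF even_bound, of N "Suc k"] even eq by auto
  qed (rule unit)
  obtain \<alpha> where \<alpha>: "\<alpha> \<in># M" "\<And>y. y \<in># M \<Longrightarrow> \<bar>y\<bar> \<le> \<bar>\<alpha>\<bar>" "2 * count M \<alpha> \<le> size M"
    "\<And>y. y \<in># M \<Longrightarrow> y \<noteq> \<alpha> \<Longrightarrow>
      even_degree_bound (size M + 2) k * (\<alpha>\<^sup>2 + y\<^sup>2 + 1) ^ k \<le> 2 * real (Suc k) * hom_sym (2 * Suc k) M"
    using minimiser_structure[OF even_bound min even] by blast
  have bound: "2 * real (Suc k) * hom_sym (2 * Suc k) M =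
      even_degree_bound (?n + 2) k * (2 / real ?n + 1) ^ k"
    unfolding eq even_degree_bound_Suc[OF even n] using \<open>M \<noteq> {#}\<close> by (simp add: add_divide_distrib add.commute)
  have le: "\<alpha>\<^sup>2 + y\<^sup>2 \<le> 2 / real ?n" if "y \<in># M" "y \<noteq> \<alpha>" for y
  proof -
    have "even_degree_bound (?n + 2) k > 0"
      by (rule even_degree_bound_pos) simp
    then have "(\<alpha>\<^sup>2 + y\<^sup>2 + 1) ^ k \<le> (2 / real ?n + 1) ^ k"
      using \<alpha>(4)[OF that] bound by simp
    then show ?thesis
      using \<open>k \<ge> 1\<close> by (subst (asm) power_mono_iff) auto
  qed
  (* The estimate for pairs is thus attained, which makes M, \<alpha>, y an equality case for k. *)
  have half_or_square: "2 * count M \<alpha> = ?n \<or> \<alpha>\<^sup>2 = 1 / real ?n"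
    by (rule extremal_partner(1)[OF unit \<alpha>(1)]) (use \<alpha>(2,3) le in auto)
  have partner: "\<alpha>\<^sup>2 + y\<^sup>2 = 2 / real ?n" if "y \<in># M" "y \<noteq> \<alpha>" for y
    by (rule extremal_partner(2)[OF unit \<alpha>(1)]) (use \<alpha>(2,3) le that in auto)
  have sum0: "\<alpha> + y + \<Sum>\<^sub># M = 0" if y: "y \<in># M" "y \<noteq> \<alpha>" for y
  proof -
    let ?N = "add_mset \<alpha> (add_mset y M)"
    have sq: "sum_squares ?N = 2 / real ?n + 1"
      using partner[OF y] unit by simp
    have "hom_sym (2 * k) ?N = even_degree_bound (size ?N) k * sum_squares ?N ^ k"
      using minimiser_pair[OF min \<alpha>(1) y(1)] y(2) bound unfolding sq by simp
    moreover have "sum_squares ?N > 0"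
      unfolding sq by (simp add: add_nonneg_pos)
    ultimately have "\<Sum>\<^sub># ?N = 0"
      using even by (intro sum_zero) auto
    then show ?thesis by simp
  qed
  obtain \<beta> where \<beta>: "\<beta> \<in># M" "\<beta> \<noteq> \<alpha>"
    using exists_other_entry[OF \<alpha>(3) \<open>M \<noteq> {#}\<close>] by blast
  have "y = \<beta>" if "y \<in># M" "y \<noteq> \<alpha>" for y
    using sum0[OF that] sum0[OF \<beta>] by linarith
  then have "count M y = 0" if "y \<noteq> \<alpha>" "y \<noteq> \<beta>" for y
    using that by (metis not_in_iff)
  then have M: "M = replicate_mset (count M \<alpha>) \<alpha> + replicate_mset (count M \<beta>) \<beta>"
    using \<beta>(2) by (auto simp: multiset_eq_iff)
  let ?A = "real (count M \<alpha>)" and ?B = "real (count M \<beta>)"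
  have size_M: "size M = count M \<alpha> + count M \<beta>"
    by (subst M) simp
  have sum_M: "\<Sum>\<^sub># M = ?A * \<alpha> + ?B * \<beta>"
    by (subst M) simp
  have opposite: "\<beta> = - \<alpha>"
    using half_or_square
  proof
    assume "2 * count M \<alpha> = size M"
    then have "?B = ?A" using size_M by simp
    then have "(?A + 1) * (\<alpha> + \<beta>) = 0"
      using sum0[OF \<beta>] sum_M by (simp add: algebra_simps)
    moreover have "?A + 1 \<noteq> 0" by linarith
    ultimately show ?thesis by simp
  next
    assume "\<alpha>\<^sup>2 = 1 / real ?n"
    then have "\<beta>\<^sup>2 = \<alpha>\<^sup>2" using partner[OF \<beta>] by simp
    then show ?thesis using \<beta>(2) by (auto simp: power2_eq_iff)
  qed
  then have "(?A - ?B) * \<alpha> = 0"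
    using sum0[OF \<beta>] sum_M by (simp add: algebra_simps)
  then have "count M \<alpha> = count M \<beta>"
    using \<beta>(2) opposite by auto
  with M opposite size_M unit show ?thesis
    using opposite_pairs_eq_balanced[of "count M \<alpha>" \<alpha>] by (simp add: mult_2)
qed

text \<open>In degree two the bound is half the sum of squares, so the excess is half the square of the
  sum.  In higher degrees an equality case is a multiple of a balanced multiset.\<close>

lemma equality_imp_sum_zero:
  assumes "k \<ge> 1" "even (size M)" "sum_squares M > 0"
    and "hom_sym (2 * k) M = even_degree_bound (size M) k * sum_squares M ^ k"
  shows "\<Sum>\<^sub># M = 0"
  using assms
proof (induction k arbitrary: M rule: nat_induct_at_least)
  case base
  have "size M > 0"
    using base by (auto simp: nonempty_has_size[symmetric])
  then have "even_degree_bound (size M) 1 = 1 / 2"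
    using base(1) by (auto simp: even_degree_bound_def fact_reduce field_simps elim!: evenE)
  then have "2 * hom_sym 2 M = sum_squares M"
    using base(3) by simp
  then have "(\<Sum>\<^sub># M)\<^sup>2 = 0"
    using hom_sym_2[of M] by (simp add: sum_squares_def)
  then show ?case by simp
next
  case (Suc k)
  obtain N s where N: "s > 0" "s\<^sup>2 = sum_squares M" "sum_squares N = 1"
    "M = image_mset ((*) s) N"
    using \<open>sum_squares M > 0\<close> by (rule unit_multiset_scaling)
  have "s ^ (2 * Suc k) * hom_sym (2 * Suc k) N = hom_sym (2 * Suc k) M"
    unfolding N(4) hom_sym_scale ..
  also have "\<dots> = s ^ (2 * Suc k) * even_degree_bound (size N) (Suc k)"
    unfolding Suc.prems(3) N(2)[symmetric] power_mult by (simp add: N(4))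
  finally have "hom_sym (2 * Suc k) N = even_degree_bound (size N) (Suc k)"
    using N(1) by simp
  moreover have "even (size N)"
    using Suc.prems(1) N(4) by simp
  ultimately have "N = balanced_multiset (size N)"
    using equality_imp_balanced[OF Suc.hyps Suc.IH _ N(3)] by blast
  then have "\<Sum>\<^sub># N = 0"
    by (metis sum_balanced_multiset)
  then show ?case
    unfolding N(4) by (simp flip: sum_mset_distrib_left)
qed

lemma is_rearrangement_iff_image_mset:
  "is_rearrangement n a b \<longleftrightarrow> image_mset a (mset_set {1..n}) = image_mset b (mset_set {1..n})"
  unfolding is_rearrangement_def
proof
  assume "\<exists>p. p permutes {1..n} \<and> (\<forall>i\<in>{1..n}. a i = b (p i))"
  then obtain p where "p permutes {1..n}" "\<And>i. i \<in> {1..n} \<Longrightarrow> a i = b (p i)"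
    by blast
  then show "image_mset a (mset_set {1..n}) = image_mset b (mset_set {1..n})"
    by (rule permutes_implies_image_mset_eq[symmetric])
next
  assume "image_mset a (mset_set {1..n}) = image_mset b (mset_set {1..n})"
  then show "\<exists>p. p permutes {1..n} \<and> (\<forall>i\<in>{1..n}. a i = b (p i))"
    using image_mset_eq_implies_permutes[OF finite_atLeastAtMost] by blast
qed

lemma image_mset_balanced_vector:
  assumes "even n"
  shows "image_mset (balanced_vector n) (mset_set {1..n}) = balanced_multiset n"
proof -
  from assms obtain m where n: "n = 2 * m" by (rule evenE)
  have "{1..n} = {1..m} \<union> {Suc m..n}"
    by (auto simp: n)
  then have "mset_set {1..n} = mset_set {1..m} + mset_set {Suc m..n}"
    by (simp add: mset_set_Union)
  moreover have "image_mset (balanced_vector n) (mset_set {1..m}) =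
      image_mset (\<lambda>_. 1 / sqrt n) (mset_set {1..m})"
    by (rule image_mset_cong) (auto simp: balanced_vector_def n)
  moreover have "image_mset (balanced_vector n) (mset_set {Suc m..n}) =
      image_mset (\<lambda>_. - (1 / sqrt n)) (mset_set {Suc m..n})"
    by (rule image_mset_cong) (auto simp: balanced_vector_def n)
  ultimately show ?thesis
    by (simp add: image_mset_const_eq balanced_multiset_def n)
qed

theorem theorem3p2:
  fixes n r :: nat and a :: "nat \<Rightarrow> real"
  assumes "even n" and "n > 0"
    and "(\<Sum>i=1..n. (a i)\<^sup>2) = 1"
    and "r \<ge> 1"
  shows "complete_homogeneous (2 * r) n a \<ge> even_degree_bound n r
    \<and> (\<exists>b. (\<Sum>i=1..n. (b i)\<^sup>2) = 1 \<and> complete_homogeneous (2 * r) n b = even_degree_bound n r)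
    \<and> (is_rearrangement n a (balanced_vector n)
         \<longrightarrow> complete_homogeneous (2 * r) n a = even_degree_bound n r)
    \<and> (r \<ge> 2 \<or> n = 2 \<longrightarrow>
         (complete_homogeneous (2 * r) n a = even_degree_bound n r
           \<longleftrightarrow> is_rearrangement n a (balanced_vector n)))"
proof -
  define M where "M = image_mset a (mset_set {1..n})"
  have size_M: "size M = n" by (simp add: M_def)
  have unit: "sum_squares M = 1"
    using assms(3) by (simp add: M_def sum_squares_image_mset)
  have ch: "complete_homogeneous (2 * r) n a = hom_sym (2 * r) M"
    by (simp add: M_def complete_homogeneous_eq_hom_sym)
  have rearr: "is_rearrangement n a (balanced_vector n) \<longleftrightarrow> M = balanced_multiset n"
    unfolding is_rearrangement_iff_image_mset image_mset_balanced_vector[OF assms(1)] M_def ..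
  have "M \<noteq> {#}" using unit by auto
  then have bound: "hom_sym (2 * r) M \<ge> even_degree_bound n r"
    using even_bound_holdsD[OF even_bound, of M r] unit size_M assms(1) by simp
  have attained: "\<exists>b. (\<Sum>i=1..n. (b i)\<^sup>2) = 1 \<and> complete_homogeneous (2 * r) n b = even_degree_bound n r"
  proof (intro exI conjI)
    show "(\<Sum>i=1..n. (balanced_vector n i)\<^sup>2) = 1"
      using sum_squares_balanced_multiset[OF assms(1,2)]
      unfolding image_mset_balanced_vector[OF assms(1), symmetric] sum_squares_image_mset .
    show "complete_homogeneous (2 * r) n (balanced_vector n) = even_degree_bound n r"
      unfolding complete_homogeneous_eq_hom_sym image_mset_balanced_vector[OF assms(1)]
      by (rule hom_sym_balanced_multiset[OF assms(1,2)])
  qed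
  have "M = balanced_multiset n"
    if eq: "hom_sym (2 * r) M = even_degree_bound n r" and "r \<ge> 2 \<or> n = 2"
  proof (cases "r \<ge> 2")
    case True
    then obtain k where k: "r = Suc k" "k \<ge> 1"
      by (cases r) auto
    have "M = balanced_multiset (size M)"
      by (rule equality_imp_balanced[OF k(2) equality_imp_sum_zero[OF k(2)]])
        (use eq unit assms(1) size_M k(1) in simp_all)
    then show ?thesis
      by (simp only: size_M)
  next
    case False
    with that(2) have "n = 2" by simp
    then have "size M = Suc (Suc 0)"
      using size_M by simp
    then obtain x N where N: "M = add_mset x N"
      by (blast dest: size_eq_Suc_imp_eq_union)
    with \<open>size M = Suc (Suc 0)\<close> have "size N = 1"
      by simp
    then obtain y where "N = {#y#}"
      by (blast dest: size_1_singleton_mset)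
    with N have M: "M = {#x, y#}"
      by simp
    have "\<Sum>\<^sub># M = 0"
      using equality_imp_sum_zero[OF assms(4), of M] eq unit size_M assms(1) by simp
    then have "y = - x"
      by (simp add: M)
    with unit show ?thesis
      using opposite_pairs_eq_balanced[of 1 x] by (simp add: M \<open>n = 2\<close> add_mset_commute)
  qed
  then have "hom_sym (2 * r) M = even_degree_bound n r \<longleftrightarrow> M = balanced_multiset n"
    if "r \<ge> 2 \<or> n = 2"
    using that hom_sym_balanced_multiset[OF assms(1,2)] by auto
  then show ?thesis
    unfolding ch rearr using bound attained hom_sym_balanced_multiset[OF assms(1,2)] by simp
qed

end
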